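(* For every integer $k\ge 2$, $\gamma_L(A_k) = k = \frac{n(A_k)}{2}$, where $n(A_k)$ is the order of $A_k$.
   Context: Graphs are finite, simple and undirected; the order of a graph is its number of vertices. For a vertex $v$ of $G$, $N(v)$ denotes its open neighborhood. A dominating set of $G$ is a set $D\subseteq V(G)$ such that every vertex outside $D$ has a neighbor in $D$. A locating-dominating set of $G$ is a dominating set $D$ such that $N(u)\cap D\neq N(v)\cap D$ for every two distinct vertices $u,v\in V(G)\setminus D$. The location-domination number $\gamma_L(G)$ is the minimum cardinality of a locating-dominating set of $G$. For an integer $k\ge 2$, $A_k$ is the graph with vertex set $\{x_1,\ldots,x_{2k}\}$ in which two distinct vertices $x_i,x_j$ are adjacent if and only if $|i-j|\le k-1$. *)

theory Defs
  imports Complex_Main "Graph_Theory.Pair_Digraph"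
begin

text \<open>
  Finite simple undirected graphs are the instances of the locale \<open>pair_graph\<close>:
  finite, symmetric and loop-free, with an edge \<open>uv\<close> stored as both \<open>(u, v)\<close> and \<open>(v, u)\<close>.
  The notions below are meant for such graphs.
\<close>

definition graph_order :: "'a pair_pre_digraph \<Rightarrow> nat" where
  "graph_order G = card (pverts G)"

definition open_neighborhood :: "'a pair_pre_digraph \<Rightarrow> 'a \<Rightarrow> 'a set" where
  "open_neighborhood G v = {u \<in> pverts G. (v, u) \<in> parcs G}"

definition dominating_set :: "'a pair_pre_digraph \<Rightarrow> 'a set \<Rightarrow> bool" where
  "dominating_set G D \<longleftrightarrow>
     D \<subseteq> pverts G \<and> (\<forall>v \<in> pverts G - D. open_neighborhood G v \<inter> D \<noteq> {})"

definition locating_dominating_set :: "'a pair_pre_digraph \<Rightarrow> 'a set \<Rightarrow> bool" where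
  "locating_dominating_set G D \<longleftrightarrow>
     dominating_set G D \<and>
     (\<forall>u \<in> pverts G - D. \<forall>v \<in> pverts G - D.
        u \<noteq> v \<longrightarrow> open_neighborhood G u \<inter> D \<noteq> open_neighborhood G v \<inter> D)"

definition location_domination_number :: "'a pair_pre_digraph \<Rightarrow> nat" where
  "location_domination_number G = Min {card D | D. locating_dominating_set G D}"

text \<open>The minimum is over a finite nonempty set.\<close>

lemma (in pair_graph) finite_locating_dominating_cards:
  "finite {card D | D. locating_dominating_set G D}"
proof -
  have "{card D | D. locating_dominating_set G D} \<subseteq> card ` Pow (pverts G)"
    by (auto simp: locating_dominating_set_def dominating_set_def)
  then show ?thesis
    by (rule finite_subset) (simp add: pair_finite_verts)
qed

lemma locating_dominating_set_pverts: "locating_dominating_set G (pverts G)"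
  by (simp add: locating_dominating_set_def dominating_set_def)

text \<open>The vertex \<open>x\<^sub>i\<close> is represented by its index \<open>i\<close>; the differences are taken in the integers.\<close>

definition A_graph :: "nat \<Rightarrow> nat pair_pre_digraph" where
  "A_graph k =
     \<lparr> pverts = {1..2 * k},
       parcs = {(i, j). i \<in> {1..2 * k} \<and> j \<in> {1..2 * k} \<and> i \<noteq> j \<and>
                        \<bar>int i - int j\<bar> \<le> int k - 1} \<rparr>"

lemma pair_graph_A_graph: "pair_graph (A_graph k)"
proof
  show "finite (parcs (A_graph k))"
    by (rule finite_subset[of _ "{1..2 * k} \<times> {1..2 * k}"]) (auto simp: A_graph_def)
  show "symmetric (with_proj (A_graph k))"
    by (auto simp: symmetric_def sym_def A_graph_def abs_minus_commute)
qed (auto simp: A_graph_def)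

end

theory Submission
  imports Defs
begin

text \<open>
  Lower bound: whether a vertex \<open>d\<close> is within distance \<open>k - 1\<close> of \<open>i\<close> changes exactly once as \<open>i\<close>
  runs through \<open>1, \<dots>, 2k\<close>. So if \<open>D\<close> is locating-dominating, then between any two vertices outside
  \<open>D\<close> there is such a threshold of an element of \<open>D\<close>. Hence \<open>2k - |D| \<le> |D| + 1\<close>,
  and so \<open>k \<le> |D|\<close> by parity. Upper bound: \<open>{1, \<dots>, k - 1} \<union> {2k}\<close> is locating-dominating.
\<close>

text \<open>Let \<open>u\<close> in \<open>U\<close> lie below \<open>Max U\<close>, with successor
  \<open>v\<close> in \<open>U\<close>. A separating \<open>s\<close> satisfies
  \<open>u \<le> s < v\<close>, so \<open>u\<close> is recovered from \<open>s\<close> as the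
  largest element of \<open>U\<close> up to \<open>s\<close>. Thus \<open>S\<close> maps onto at
  least \<open>U - {Max U}\<close>.\<close>

lemma card_le_Suc_card_separating:
  fixes U S :: "'a::linorder set"
  assumes "finite S"
    and sep: "\<And>u v. u \<in> U \<Longrightarrow> v \<in> U \<Longrightarrow> u < v \<Longrightarrow> \<exists>s\<in>S. u \<le> s \<and> s < v"
  shows "card U \<le> Suc (card S)"
proof (cases "finite U \<and> U \<noteq> {}")
  case True
  then have fin: "finite U" and ne: "U \<noteq> {}" by auto
  have "U - {Max U} \<subseteq> (\<lambda>s. Max {w \<in> U. w \<le> s}) ` S"
  proof
    fix u assume u: "u \<in> U - {Max U}"
    then have "u < Max U" using fin by (simp add: order_less_le)
    then have ne': "{w \<in> U. u < w} \<noteq> {}" using fin ne Max_in by blast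
    define v where "v = Min {w \<in> U. u < w}"
    have v: "v \<in> U" "u < v" using Min_in[OF _ ne'] fin by (auto simp: v_def)
    have least: "v \<le> w" if "w \<in> U" "u < w" for w
      using that fin by (auto simp: v_def)
    obtain s where s: "s \<in> S" "u \<le> s" "s < v" using sep[of u v] u v by auto
    have "w \<le> u" if "w \<in> U" "w \<le> s" for w
      using least[of w] that s by force
    then have "Max {w \<in> U. w \<le> s} = u"
      using u s fin by (intro Max_eqI) auto
    then show "u \<in> (\<lambda>s. Max {w \<in> U. w \<le> s}) ` S" using s(1) by blast
  qed
  then have "card (U - {Max U}) \<le> card S"
    by (rule surj_card_le[OF \<open>finite S\<close>])
  then show ?thesis using fin ne by simp
qed auto

lemma open_neighborhood_A_graph:
  assumes "v \<in> {1..2 * k}"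
  shows "open_neighborhood (A_graph k) v = {u \<in> {1..2 * k}. u \<noteq> v \<and> \<bar>int v - int u\<bar> \<le> int k - 1}"
  using assms by (auto simp: open_neighborhood_def A_graph_def)

lemma card_locating_dominating_set_A_graph:
  assumes "locating_dominating_set (A_graph k) D"
  shows "k \<le> card D"
proof -
  have D: "D \<subseteq> {1..2 * k}"
    using assms by (simp add: locating_dominating_set_def dominating_set_def A_graph_def)
  then have fin: "finite D" by (rule finite_subset) simp
  \<comment> \<open>\<open>\<sigma> d\<close> is the last index before the change. For
    \<open>d \<le> k\<close> the lower end of the range of \<open>d\<close> is at most 1, so
    vertices leave it after \<open>d + k - 1\<close>; for \<open>d > k\<close> the upper end is at
    least \<open>2 * k\<close>, so vertices enter it after \<open>d - k\<close>.\<close>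
  define \<sigma> where "\<sigma> d = (if d \<le> k then d + k - 1 else d - k)" for d
  have "card ({1..2 * k} - D) \<le> Suc (card (\<sigma> ` D))"
  proof (rule card_le_Suc_card_separating)
    fix u v assume u: "u \<in> {1..2 * k} - D" and v: "v \<in> {1..2 * k} - D" and "u < v"
    then have "open_neighborhood (A_graph k) u \<inter> D \<noteq> open_neighborhood (A_graph k) v \<inter> D"
      using assms by (simp add: locating_dominating_set_def A_graph_def)
    then obtain d where d: "d \<in> D"
      and "(d \<in> open_neighborhood (A_graph k) u) \<noteq> (d \<in> open_neighborhood (A_graph k) v)"
      by blast
    \<comment> \<open>Since \<open>u\<close> and \<open>v\<close> lie outside \<open>D\<close>, the
      clause excluding a vertex from its own neighborhood drops out and only the distances to
      \<open>d\<close> matter.\<close>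
    moreover have "d \<noteq> u" "d \<noteq> v" "d \<in> {1..2 * k}" using d u v D by auto
    ultimately have "(\<bar>int u - int d\<bar> \<le> int k - 1) \<noteq> (\<bar>int v - int d\<bar> \<le> int k - 1)"
      using u v by (simp add: open_neighborhood_A_graph)
    then have "u \<le> \<sigma> d \<and> \<sigma> d < v"
      using \<open>u < v\<close> \<open>d \<in> {1..2 * k}\<close> u v unfolding \<sigma>_def
      by (cases "d \<le> k") (simp_all, arith+)
    then show "\<exists>s\<in>\<sigma> ` D. u \<le> s \<and> s < v" using d by blast
  qed (simp add: fin)
  \<comment> \<open>Only an inequality: for \<open>k \<ge> 1\<close> the vertices \<open>1\<close>
    and \<open>2 * k\<close> share the threshold \<open>k\<close>.\<close>
  also have "\<dots> \<le> Suc (card D)" using card_image_le[OF fin] by simp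
  finally have "2 * k - card D \<le> Suc (card D)"
    using D fin by (simp add: card_Diff_subset)
  then show ?thesis by simp
qed

lemma locating_dominating_set_A_graph:
  assumes "k \<ge> 2"
  shows "locating_dominating_set (A_graph k) (insert (2 * k) {1..<k})"
proof -
  define D where "D = insert (2 * k) {1..<k}"
  have out: "pverts (A_graph k) - D = {k..<2 * k}" using assms by (auto simp: D_def A_graph_def)
  \<comment> \<open>As \<open>v\<close> grows, the trace on \<open>{1..<k}\<close> loses its least
    element at each step, and it is empty at \<open>v = 2 * k - 1\<close>. The vertex
    \<open>2 * k\<close> dominates everything outside \<open>D\<close> except \<open>k\<close>,
    whose trace is all of \<open>{1..<k}\<close>, nonempty by \<open>k \<ge> 2\<close>.\<close>
  have nb: "open_neighborhood (A_graph k) v \<inter> D =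
      {Suc v - k..<k} \<union> (if v = k then {} else {2 * k})" if "v \<in> {k..<2 * k}" for v
    using that assms by (auto simp: open_neighborhood_A_graph D_def)
  have dom: "open_neighborhood (A_graph k) v \<inter> D \<noteq> {}" if "v \<in> {k..<2 * k}" for v
    unfolding nb[OF that] using assms by auto
  have sep: "open_neighborhood (A_graph k) u \<inter> D \<noteq> open_neighborhood (A_graph k) v \<inter> D"
    if "u \<in> {k..<2 * k}" "v \<in> {k..<2 * k}" "u < v" for u v
  proof (cases "u = k")
    case True
    then have "2 * k \<notin> open_neighborhood (A_graph k) u \<inter> D"
      and "2 * k \<in> open_neighborhood (A_graph k) v \<inter> D"
      using that unfolding nb[OF that(1)] nb[OF that(2)] by auto
    then show ?thesis by blast
  next
    case False
    \<comment> \<open>The least element of the trace of \<open>u\<close> on \<open>{1..<k}\<close>;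
      it exists because \<open>u < v < 2 * k\<close> gives \<open>Suc u - k < k\<close>.\<close>
    then have "Suc u - k \<in> open_neighborhood (A_graph k) u \<inter> D"
      and "Suc u - k \<notin> open_neighborhood (A_graph k) v \<inter> D"
      using that unfolding nb[OF that(1)] nb[OF that(2)] by auto
    then show ?thesis by blast
  qed
  have "locating_dominating_set (A_graph k) D"
    unfolding locating_dominating_set_def dominating_set_def
  proof (intro conjI ballI impI)
    show "D \<subseteq> pverts (A_graph k)" using assms by (auto simp: D_def A_graph_def)
  next
    fix v assume "v \<in> pverts (A_graph k) - D"
    then show "open_neighborhood (A_graph k) v \<inter> D \<noteq> {}"
      using dom unfolding out by blast
  next
    fix u v assume "u \<in> pverts (A_graph k) - D" "v \<in> pverts (A_graph k) - D" "u \<noteq> v"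
    then have "u \<in> {k..<2 * k}" "v \<in> {k..<2 * k}" "u < v \<or> v < u"
      unfolding out by auto
    then show "open_neighborhood (A_graph k) u \<inter> D \<noteq> open_neighborhood (A_graph k) v \<inter> D"
      using sep[of u v] sep[of v u] by metis
  qed
  then show ?thesis by (simp add: D_def)
qed

theorem proposition6:
  fixes k :: nat
  assumes "k \<ge> 2"
  shows "location_domination_number (A_graph k) = k \<and>
         real k = real (graph_order (A_graph k)) / 2"
proof
  have "card (insert (2 * k) {1..<k}) = k" using assms by simp
  then have "k \<in> {card D | D. locating_dominating_set (A_graph k) D}"
    using locating_dominating_set_A_graph[OF assms] by (metis (mono_tags, lifting) mem_Collect_eq)
  then show "location_domination_number (A_graph k) = k"
    unfolding location_domination_number_def
    using pair_graph.finite_locating_dominating_cards[OF pair_graph_A_graph]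
    by (intro Min_eqI) (auto intro: card_locating_dominating_set_A_graph)
  show "real k = real (graph_order (A_graph k)) / 2"
    by (simp add: graph_order_def A_graph_def)
qed

end
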